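(* Let $k\ge2$ and let $(\sigma_1,\dots,\sigma_k)$ be an allowable sequence of permutations in $\mathfrak{S}_n$. Then the directed graph $\mathbf{G}(\sigma_1,\dots,\sigma_k)$ has no directed cycle.
   Context: For $\sigma,\gamma\in\mathfrak{S}_n$, the pair $(\sigma,\gamma)$ is allowable if (a) for all $1\le i<j\le n$, $\sigma(i)>\sigma(j)$ implies $\gamma(i)>\gamma(j)$, and (b) for all $1\le i<j<k\le n$ with $\sigma(i)<\sigma(j)<\sigma(k)$, it is not the case that $\gamma(j)<\gamma(k)<\gamma(i)$. A sequence $(\sigma_1,\dots,\sigma_k)$ with $k\ge2$ is an allowable sequence if $(\sigma_j,\sigma_{j+1})$ is allowable for every $1\le j\le k-1$. The directed graph $\mathbf{G}(\sigma_1,\dots,\sigma_k)$ has vertex set $\{(i,j):1\le i\le n,\,1\le j\le k\}$ and edges: horizontal edges $(i,j)\to(i,j+1)$ for $1\le j\le k-1$; vertical edges $(p,j)\to(i,j)$ for $i\ne p$ with $\sigma_j(i)<\sigma_j(p)$; diagonal edges $(p,j)\to(i,j-1)$ for $2\le j\le k$ and $1\le i<p\le n$ with $\sigma_j(i)<\sigma_j(p)$. *)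

theory Defs
  imports "HOL-Combinatorics.Permutations" "Graph_Theory.Pair_Digraph"
begin

text \<open>
  Elements of the symmetric group on \<open>{1..n}\<close> are functions \<open>\<sigma> :: nat \<Rightarrow> nat\<close> with
  \<open>\<sigma> permutes {1..n}\<close>. A sequence of \<open>k\<close> permutations is a function \<open>\<sigma>\<close> whose value
  \<open>\<sigma> j\<close> matters only for \<open>j \<in> {1..k}\<close>.
\<close>

definition allowable :: "nat \<Rightarrow> (nat \<Rightarrow> nat) \<Rightarrow> (nat \<Rightarrow> nat) \<Rightarrow> bool" where
  "allowable n \<sigma> \<gamma> \<longleftrightarrow>
     (\<forall>i j. 1 \<le> i \<and> i < j \<and> j \<le> n \<and> \<sigma> i > \<sigma> j \<longrightarrow> \<gamma> i > \<gamma> j) \<and>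
     (\<forall>i j k. 1 \<le> i \<and> i < j \<and> j < k \<and> k \<le> n \<and> \<sigma> i < \<sigma> j \<and> \<sigma> j < \<sigma> k
        \<longrightarrow> \<not> (\<gamma> j < \<gamma> k \<and> \<gamma> k < \<gamma> i))"

definition allowable_sequence :: "nat \<Rightarrow> nat \<Rightarrow> (nat \<Rightarrow> nat \<Rightarrow> nat) \<Rightarrow> bool" where
  "allowable_sequence n k \<sigma> \<longleftrightarrow>
     k \<ge> 2 \<and> (\<forall>j. 1 \<le> j \<and> j \<le> k - 1 \<longrightarrow> allowable n (\<sigma> j) (\<sigma> (j + 1)))"

definition horizontal_edges :: "nat \<Rightarrow> nat \<Rightarrow> (nat \<times> nat) rel" where
  "horizontal_edges n k =
     {((i, j), (i, j + 1)) |i j. 1 \<le> i \<and> i \<le> n \<and> 1 \<le> j \<and> j \<le> k - 1}"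

definition vertical_edges :: "nat \<Rightarrow> nat \<Rightarrow> (nat \<Rightarrow> nat \<Rightarrow> nat) \<Rightarrow> (nat \<times> nat) rel" where
  "vertical_edges n k \<sigma> =
     {((p, j), (i, j)) |p i j. i \<in> {1..n} \<and> p \<in> {1..n} \<and> j \<in> {1..k} \<and>
                               i \<noteq> p \<and> \<sigma> j i < \<sigma> j p}"

definition diagonal_edges :: "nat \<Rightarrow> nat \<Rightarrow> (nat \<Rightarrow> nat \<Rightarrow> nat) \<Rightarrow> (nat \<times> nat) rel" where
  "diagonal_edges n k \<sigma> =
     {((p, j), (i, j - 1)) |p i j. 2 \<le> j \<and> j \<le> k \<and> 1 \<le> i \<and> i < p \<and> p \<le> n \<and>
                                   \<sigma> j i < \<sigma> j p}"

definition perm_digraph ::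
    "nat \<Rightarrow> nat \<Rightarrow> (nat \<Rightarrow> nat \<Rightarrow> nat) \<Rightarrow> (nat \<times> nat) pair_pre_digraph" where
  "perm_digraph n k \<sigma> =
     \<lparr> pverts = {1..n} \<times> {1..k},
       parcs = horizontal_edges n k \<union> vertical_edges n k \<sigma> \<union> diagonal_edges n k \<sigma> \<rparr>"

end

theory Submission
  imports Defs
begin

text \<open>
  An excursion into the last column enters it horizontally, descends vertically and leaves it
  diagonally. Allowability guarantees that such an excursion can be replaced by a vertical edge
  of the previous column. A cycle meeting an earlier column can thus be pushed out of the last
  column, and a cycle inside the last column is impossible because \<open>\<sigma>\<close> decreases strictly along
  its vertical edges; so induction on the number of columns applies.
\<close>

text \<open>Consecutive columns \<open>\<sigma>\<close>, \<open>\<gamma>\<close>: the excursion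
  enters \<open>\<gamma>\<close> at row \<open>i\<close>, descends to row \<open>p\<close> and
  leaves for row \<open>q\<close>. If \<open>\<sigma> i < \<sigma> q\<close>, condition (a), read
  contrapositively, forces \<open>i < q\<close> and \<open>\<sigma> q < \<sigma> p\<close>; then
  \<open>i < q < p\<close> is the configuration excluded by condition (b).\<close>

lemma allowable_shortcut:
  assumes "allowable n \<sigma> \<gamma>" "inj \<sigma>" "inj \<gamma>"
    and "i \<in> {1..n}" "1 \<le> q" "q < p" "p \<le> n"
    and "\<gamma> q < \<gamma> p" "\<gamma> p \<le> \<gamma> i"
  shows "\<sigma> q < \<sigma> i"
proof (rule ccontr)
  assume "\<not> \<sigma> q < \<sigma> i"
  moreover have "q \<noteq> i" using assms by auto
  ultimately have iq: "\<sigma> i < \<sigma> q"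
    using \<open>inj \<sigma>\<close> by (metis injD linorder_neqE_nat)
  have inv: "\<gamma> b < \<gamma> a" if "1 \<le> a" "a < b" "b \<le> n" "\<sigma> b < \<sigma> a" for a b
    using assms(1) that unfolding allowable_def by blast
  have "i < q"
    using inv[of q i] iq \<open>q \<noteq> i\<close> assms by fastforce
  moreover have "\<sigma> q < \<sigma> p"
    using inv[of q p] assms by (metis injD less_asym linorder_neqE_nat)
  \<comment> \<open>Equality is excluded because \<open>i < q < p\<close> separates \<open>p\<close>
    from \<open>i\<close>.\<close>
  moreover have "\<gamma> p < \<gamma> i"
    using assms \<open>i < q\<close> by (metis injD le_neq_implies_less less_asym)
  ultimately show False
    using assms iq unfolding allowable_def by auto
qed

text \<open>Writing columns with \<open>Suc\<close> instead of truncated subtraction lets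
  \<open>auto\<close> settle every case split on edges.\<close>

lemma parcs_perm_digraph_iff:
  "((a, b), (c, d)) \<in> parcs (perm_digraph n k \<sigma>) \<longleftrightarrow>
     a \<in> {1..n} \<and> c \<in> {1..n} \<and> b \<in> {1..k} \<and> d \<in> {1..k} \<and>
     (c = a \<and> d = Suc b \<or> d = b \<and> \<sigma> b c < \<sigma> b a \<or> b = Suc d \<and> c < a \<and> \<sigma> b c < \<sigma> b a)"
  unfolding perm_digraph_def horizontal_edges_def vertical_edges_def diagonal_edges_def
  by auto

text \<open>The second alternative is the invariant during an excursion: \<open>i\<close> is the row
  of entry, and only vertical steps have been taken since. The path to \<open>(i, k)\<close> is
  reflexive because the walk may start there.\<close>

lemma trancl_Suc_column:
  assumes "(x, y) \<in> (parcs (perm_digraph n (Suc k) \<sigma>))\<^sup>+" "snd x \<le> k"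
    and "\<And>j. j \<in> {1..Suc k} \<Longrightarrow> inj (\<sigma> j)"
    and "\<And>j. j \<in> {1..k} \<Longrightarrow> allowable n (\<sigma> j) (\<sigma> (Suc j))"
  shows "if snd y \<le> k then (x, y) \<in> (parcs (perm_digraph n k \<sigma>))\<^sup>+
    else \<exists>i. i \<in> {1..n} \<and> \<sigma> (Suc k) (fst y) \<le> \<sigma> (Suc k) i \<and> (x, (i, k)) \<in> (parcs (perm_digraph n k \<sigma>))\<^sup>*"
  (is "if _ then _ \<in> ?E\<^sup>+ else _")
  using assms(1)
proof (induction rule: trancl_induct)
  case (base y)
  obtain a b c d where xy: "x = (a, b)" "y = (c, d)" by fastforce
  show ?case
  proof (cases "d \<le> k")
    case True
    then have "(x, y) \<in> ?E"
      using base assms(2) unfolding xy by (auto simp: parcs_perm_digraph_iff)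
    then show ?thesis using True xy by auto
  next
    case False
    \<comment> \<open>Only a horizontal edge enters the last column, so the entry row is
      \<open>a\<close> and the path to \<open>(a, k)\<close> is empty.\<close>
    then have "c = a" "b = k" "a \<in> {1..n}"
      using base assms(2) unfolding xy by (auto simp: parcs_perm_digraph_iff)
    then show ?thesis using False xy by auto
  qed
next
  case (step y z)
  obtain a b c d where yz: "y = (a, b)" "z = (c, d)" by fastforce
  note edge = step.hyps(2)[unfolded yz parcs_perm_digraph_iff]
  show ?case
  proof (cases "b \<le> k")
    case True
    then have path: "(x, y) \<in> ?E\<^sup>+" using step.IH yz by simp
    show ?thesis
    proof (cases "d \<le> k")
      case dk: True
      then have "(y, z) \<in> ?E"
        using edge True unfolding yz by (auto simp: parcs_perm_digraph_iff)
      with path have "(x, z) \<in> ?E\<^sup>+" by (rule trancl_into_trancl)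
      then show ?thesis using dk yz by simp
    next
      case False
      then have "c = a" "b = k" "a \<in> {1..n}" using edge True by auto
      then show ?thesis
        using False yz trancl_into_rtrancl[OF path] by auto
    qed
  next
    case False
    then obtain i where i: "i \<in> {1..n}" "\<sigma> (Suc k) a \<le> \<sigma> (Suc k) i" "(x, (i, k)) \<in> ?E\<^sup>*"
      using step.IH yz by auto
    have b: "b = Suc k" using False edge by auto
    show ?thesis
    proof (cases "d \<le> k")
      case True
      then have d: "d = k" "k \<in> {1..k}" "c < a" "\<sigma> (Suc k) c < \<sigma> (Suc k) a"
        using edge b by auto
      \<comment> \<open>The excursion ends here: a vertical edge from \<open>(i, k)\<close> to
        \<open>(c, k)\<close> replaces it.\<close>
      have "\<sigma> k c < \<sigma> k i"
        by (rule allowable_shortcut[where p = a and \<gamma> = "\<sigma> (Suc k)" and n = n])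
          (use assms(3,4) d i edge in auto)
      then have "((i, k), z) \<in> ?E"
        using d i edge unfolding yz by (auto simp: parcs_perm_digraph_iff)
      with i(3) have "(x, z) \<in> ?E\<^sup>+" by (rule rtrancl_into_trancl1)
      then show ?thesis using True yz by simp
    next
      case False
      \<comment> \<open>A further descent inside the last column keeps the entry row
        \<open>i\<close>.\<close>
      then have "\<sigma> (Suc k) c < \<sigma> (Suc k) a" using edge b by auto
      then show ?thesis using False i yz by (auto intro!: exI[of _ i])
    qed
  qed
qed

text \<open>On a closed walk the first alternative would put a value strictly below itself, so the
  walk visits a vertex \<open>z\<close> of an earlier column.\<close>

lemma trancl_from_last_column:
  assumes "(x, y) \<in> (parcs (perm_digraph n (Suc k) \<sigma>))\<^sup>+" "snd x = Suc k"
  shows "snd y = Suc k \<and> \<sigma> (Suc k) (fst y) < \<sigma> (Suc k) (fst x) \<or>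
    (\<exists>z. snd z \<le> k \<and> (x, z) \<in> (parcs (perm_digraph n (Suc k) \<sigma>))\<^sup>+ \<and>
         (z, y) \<in> (parcs (perm_digraph n (Suc k) \<sigma>))\<^sup>*)"
  (is "_ \<or> (\<exists>z. _ \<and> _ \<in> ?E\<^sup>+ \<and> _)")
  using assms(1)
proof (induction rule: trancl_induct)
  case (base y)
  show ?case
  proof (cases "snd y \<le> k")
    case True
    then show ?thesis using base by blast
  next
    case False
    then show ?thesis
      using base assms(2) by (cases x; cases y) (auto simp: parcs_perm_digraph_iff)
  qed
next
  case (step y z)
  show ?case
  proof (cases "snd z \<le> k")
    case True
    moreover have "(x, z) \<in> ?E\<^sup>+" using step.hyps by (rule trancl_into_trancl)
    ultimately show ?thesis by blast
  next
    case False
    from step.IH show ?thesis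
    proof
      assume "snd y = Suc k \<and> \<sigma> (Suc k) (fst y) < \<sigma> (Suc k) (fst x)"
      then show ?thesis
        using False step.hyps(2) by (cases y; cases z) (auto simp: parcs_perm_digraph_iff)
    next
      assume "\<exists>w. snd w \<le> k \<and> (x, w) \<in> ?E\<^sup>+ \<and> (w, y) \<in> ?E\<^sup>*"
      then show ?thesis using step.hyps(2) by (meson rtrancl.rtrancl_into_rtrancl)
    qed
  qed
qed

text \<open>No lower bound on \<open>k\<close> is imposed, so the induction can start from the graph
  with no columns.\<close>

lemma acyclic_perm_digraph:
  assumes "\<And>j. j \<in> {1..k} \<Longrightarrow> inj (\<sigma> j)"
    and "\<And>j. j \<in> {1..<k} \<Longrightarrow> allowable n (\<sigma> j) (\<sigma> (Suc j))"
  shows "acyclic (parcs (perm_digraph n k \<sigma>))"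
  using assms
proof (induction k)
  case 0
  have "parcs (perm_digraph n 0 \<sigma>) = {}"
    by (auto simp: parcs_perm_digraph_iff)
  then show ?case by (simp add: acyclic_def)
next
  case (Suc k)
  let ?E = "parcs (perm_digraph n (Suc k) \<sigma>)"
  have IH: "acyclic (parcs (perm_digraph n k \<sigma>))"
    using Suc.prems by (intro Suc.IH) auto
  have early: "(x, x) \<notin> ?E\<^sup>+" if "snd x \<le> k" for x
  proof
    assume "(x, x) \<in> ?E\<^sup>+"
    from trancl_Suc_column[OF this that] Suc.prems that
    have "(x, x) \<in> (parcs (perm_digraph n k \<sigma>))\<^sup>+" by simp
    then show False using IH unfolding acyclic_def by blast
  qed
  show ?case
    unfolding acyclic_def
  proof (intro allI notI)
    fix x assume x: "(x, x) \<in> ?E\<^sup>+"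
    then obtain y where "(x, y) \<in> ?E" by (meson tranclD)
    then have "snd x \<le> Suc k"
      by (cases x; cases y) (auto simp: parcs_perm_digraph_iff)
    moreover have "\<not> snd x \<le> k" using early x by blast
    ultimately have "snd x = Suc k" by simp
    from trancl_from_last_column[OF x this] obtain z
      where "snd z \<le> k" "(x, z) \<in> ?E\<^sup>+" "(z, x) \<in> ?E\<^sup>*" by auto
    \<comment> \<open>Rotating the closed walk makes it start at \<open>z\<close>, where
      \<open>early\<close> applies.\<close>
    then show False using early by (meson rtrancl_trancl_trancl)
  qed
qed

lemma pair_wf_digraph_perm_digraph: "pair_wf_digraph (perm_digraph n k \<sigma>)"
  by unfold_locales
    (auto simp: perm_digraph_def horizontal_edges_def vertical_edges_def diagonal_edges_def)

theorem theorem5p5: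
  fixes n k :: nat and \<sigma> :: "nat \<Rightarrow> nat \<Rightarrow> nat"
  assumes "k \<ge> 2"
    and "\<And>j. j \<in> {1..k} \<Longrightarrow> \<sigma> j permutes {1..n}"
    and "allowable_sequence n k \<sigma>"
  shows "\<not> (\<exists>c. pre_digraph.cycle (with_proj (perm_digraph n k \<sigma>)) c)"
proof
  interpret pair_wf_digraph "perm_digraph n k \<sigma>"
    by (rule pair_wf_digraph_perm_digraph)
  assume "\<exists>c. cycle c"
  then obtain c u where "c \<noteq> []" "awalk u c u"
    unfolding cycle_conv by auto
  then have "(u, u) \<in> (parcs (perm_digraph n k \<sigma>))\<^sup>+"
    by (auto intro: reachable1_awalkI)
  moreover have "acyclic (parcs (perm_digraph n k \<sigma>))"
    using assms(3) unfolding allowable_sequence_def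
    by (intro acyclic_perm_digraph permutes_inj[OF assms(2)]) auto
  ultimately show False
    unfolding acyclic_def by blast
qed

end
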